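(* Let $A$, $B$, $C$ and $C'$ be matrices in $\mathbb{C}^{d\times d}$, with $C+kI$ and $C'+kI$ invertible for all integers $k\ge0$. Then the Horn matrix function $H_4(A,B;C,C';x,y)$ satisfies the following infinite summation formulae for $|t|<1$: (1) $(1-t)^{-A}\,H_4\!\left(A,B;C,C';\frac{x}{(1-t)^2},\frac{y}{1-t}\right)=\sum_{n=0}^{\infty}\frac{(A)_n}{n!}\,H_4(A+nI,B;C,C';x,y)\,t^n$; (2) if $AB=BA$, $(1-t)^{-B}\,H_4\!\left(A,B;C,C';x,\frac{y}{1-t}\right)=\sum_{n=0}^{\infty}\frac{(B)_n}{n!}\,H_4(A,B+nI;C,C';x,y)\,t^n$.
   Context: $H_4(A,B;C,C';x,y)=\sum_{m,n=0}^{\infty}(A)_{2m+n}(B)_n(C)_m^{-1}(C')_n^{-1}\frac{x^m y^n}{m!\,n!}$. Matrix Pochhammer symbol: for $M\in\mathbb{C}^{d\times d}$, $(M)_0=I$, $(M)_n=M(M+I)\cdots(M+(n-1)I)$ for $n\ge1$; $(M)_n^{-1}$ is the inverse matrix of $(M)_n$. For $|t|<1$, $(1-t)^{-M}=\sum_{n\ge0}\frac{(M)_n}{n!}t^n$.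
   Formalization: Assumes the H_4 arguments on both sides satisfy 2√|x|+|y|<1 and the series in t converges, or that this bound holds with 1-t replaced by 1-|t| (then convergence is proved). For |t|<1 alone it fails: d=1, A=B=C=C'=1, x=0, y=1/2, t=-3/4. *)

theory Defs
  imports "HOL-Analysis.Analysis"
begin

text \<open>The library's \<open>*s\<close> scales a vector by an element of its own entry type, so it does not
  scale a matrix \<open>complex ^ 'd ^ 'd\<close> by a complex number.\<close>

definition cscale :: "complex \<Rightarrow> complex ^ 'd ^ 'd \<Rightarrow> complex ^ 'd ^ 'd" (infixr "*\<^sub>m" 75) where
  "c *\<^sub>m M = (\<chi> i j. c * M $ i $ j)"

primrec mpoch :: "complex ^ 'd ^ 'd \<Rightarrow> nat \<Rightarrow> complex ^ 'd ^ 'd" where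
  "mpoch M 0 = mat 1"
| "mpoch M (Suc n) = mpoch M n ** (M + mat (of_nat n))"

text \<open>\<open>(1 - t)\<close> to the matrix power \<open>- M\<close>, by its binomial series; meaningful for \<open>norm t < 1\<close>.\<close>

definition one_minus_pow_neg :: "complex \<Rightarrow> complex ^ 'd ^ 'd \<Rightarrow> complex ^ 'd ^ 'd" where
  "one_minus_pow_neg t M = (\<Sum>n. (t ^ n / fact n) *\<^sub>m mpoch M n)"

definition H4_term ::
  "complex ^ 'd ^ 'd \<Rightarrow> complex ^ 'd ^ 'd \<Rightarrow> complex ^ 'd ^ 'd \<Rightarrow> complex ^ 'd ^ 'd \<Rightarrow>
   complex \<Rightarrow> complex \<Rightarrow> nat \<Rightarrow> nat \<Rightarrow> complex ^ 'd ^ 'd" where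
  "H4_term A B C C' x y m n =
     (x ^ m * y ^ n / (fact m * fact n)) *\<^sub>m
       (mpoch A (2 * m + n) ** mpoch B n ** matrix_inv (mpoch C m) ** matrix_inv (mpoch C' n))"

definition H4 ::
  "complex ^ 'd ^ 'd \<Rightarrow> complex ^ 'd ^ 'd \<Rightarrow> complex ^ 'd ^ 'd \<Rightarrow> complex ^ 'd ^ 'd \<Rightarrow>
   complex \<Rightarrow> complex \<Rightarrow> complex ^ 'd ^ 'd" where
  "H4 A B C C' x y = (\<Sum>\<^sub>\<infinity>(m, n)\<in>UNIV. H4_term A B C C' x y m n)"

text \<open>The domain of absolute convergence of Horn's double series \<open>H4\<close> for generic parameters.
  The series converges absolutely there for all parameters: up to factors polynomial in \<open>m\<close> and
  \<open>n\<close>, the norm of the term with index \<open>(m, n)\<close> is at most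
  \<open>(2 * m + n)! / (m! * m! * n!) * norm x ^ m * norm y ^ n\<close>.
  Outside its closure \<open>H4\<close> is in general only the default value of \<open>infsum\<close>.\<close>

definition H4_domain :: "(complex \<times> complex) set" where
  "H4_domain = {(x, y). 2 * sqrt (norm x) + norm y < 1}"

end

theory Submission
  imports Defs "HOL-Complex_Analysis.Complex_Analysis" "HOL-Real_Asymp.Real_Asymp"
begin

text \<open>Both formulae say that a factor \<open>(1 - t)\<^bsup>-M\<^esup>\<close> can be expanded in powers of \<open>t\<close> inside the Horn
  series. Write the series as a sum of matrices \<open>b i\<close> and let the substitution in its arguments
  multiply \<open>b i\<close> by \<open>(1 - t)\<^bsup>-\<nu> i\<^esup>\<close>; here \<open>i = (m, n)\<close>, with \<open>\<nu> i = 2 * m + n\<close> and \<open>M = A\<close> for the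
  first formula, \<open>\<nu> i = n\<close> and \<open>M = B\<close> for the second. Then
  \<open>(1 - t)\<^bsup>-M\<^esup> * (1 - t)\<^bsup>-\<nu> i\<^esup> = (1 - t)\<^bsup>-(M + \<nu> i)\<^esup>\<close> is a binomial series with coefficients
  \<open>mpoch (M + \<nu> i) n / fact n\<close>, and \<open>mpoch (M + \<nu> i) n ** b i\<close> is \<open>mpoch M n\<close> times the term of
  the Horn series with \<open>M\<close> replaced by \<open>M + n\<close>. Exchanging the summations over \<open>i\<close> and \<open>n\<close> gives the
  formula.

  The exchange is legitimate where the double series converges absolutely, which is the case for
  \<open>norm t < 1 - s\<close> if \<open>b i\<close> can be multiplied by \<open>\<rho> ^ \<nu> i\<close> for all \<open>\<rho> < 1 / s\<close> without losing absolute
  convergence (\<open>one_minus_pow_neg_mult_infsum_local\<close>). The value of \<open>s\<close> is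
  \<open>2 * sqrt (norm x) + norm y\<close> in the first formula and \<open>norm y / (1 - 2 * sqrt (norm x))\<close> in the
  second. Absolute convergence of the Horn series on its domain (\<open>H4_term_norm_summable\<close>) follows from Pochhammer
  bounds \<open>K * q ^ n * fact n\<close>, and \<open>K * q ^ n / fact n\<close> for inverses, with \<open>q > 1\<close> arbitrary.

  If only convergence of the outer series at \<open>t\<close> is known, \<open>t\<close> may lie outside the disc of absolute
  convergence and even on the circle of convergence. The right side is then holomorphic on the part
  of the unit disc where \<open>norm (1 - t) > s\<close>. The power series on the left converges in the disc of
  radius \<open>norm t\<close>, so the identity extends to the intersection, which is connected, and then
  radially to \<open>t\<close> by Abel's theorem (\<open>sums_continuation\<close>).\<close>

section \<open>Matrix scaling and Pochhammer symbols\<close>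

lemma cscale_nth [simp]: "(c *\<^sub>m M) $ i $ j = c * M $ i $ j"
  by (simp add: cscale_def)

lemma cscale_cscale [simp]: "c *\<^sub>m d *\<^sub>m M = (c * d) *\<^sub>m M"
  by (simp add: vec_eq_iff)

lemma cscale_one [simp]: "1 *\<^sub>m M = M"
  by (simp add: vec_eq_iff)

lemma cscale_mult_left: "(c *\<^sub>m M) ** N = c *\<^sub>m (M ** N)"
  by (simp add: vec_eq_iff matrix_matrix_mult_def sum_distrib_left mult.assoc)

lemma cscale_mult_right: "M ** (c *\<^sub>m N) = c *\<^sub>m (M ** N)"
  by (simp add: vec_eq_iff matrix_matrix_mult_def sum_distrib_left mult_ac)

lemma cscale_diff_right: "c *\<^sub>m (M - N) = c *\<^sub>m M - c *\<^sub>m N"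
  by (simp add: vec_eq_iff ring_distribs)

lemma mat_mult_eq_cscale:
  fixes M :: "complex ^ 'd ^ 'd"
  shows "mat c ** M = c *\<^sub>m M"
  by (simp add: vec_eq_iff matrix_matrix_mult_def mat_def if_distrib if_distribR cong: if_cong)

lemma mult_mat_eq_cscale:
  fixes M :: "complex ^ 'd ^ 'd"
  shows "M ** mat c = c *\<^sub>m M"
  by (simp add: vec_eq_iff matrix_matrix_mult_def mat_def if_distrib if_distribR mult_ac cong: if_cong)

lemma norm_cscale [simp]: "norm (c *\<^sub>m M) = norm c * norm M"
  by (simp add: norm_vec_def norm_mult L2_set_right_distrib [symmetric])

lemma bounded_linear_cscale: "bounded_linear ((*\<^sub>m) c)"
  by (rule bounded_linear_intro [where K = "norm c"])
     (auto simp: vec_eq_iff ring_distribs)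

lemma bounded_bilinear_matrix_mult:
  "bounded_bilinear ((**) :: complex ^ 'd ^ 'd \<Rightarrow> _ \<Rightarrow> complex ^ 'd ^ 'd)"
  unfolding bilinear_conv_bounded_bilinear [symmetric] bilinear_def
  by (auto intro!: linearI simp: vec_eq_iff matrix_matrix_mult_def ring_distribs sum.distrib
        scaleR_sum_right)

lemma commute_add_mat:
  fixes M X :: "complex ^ 'd ^ 'd"
  assumes "M ** X = X ** M"
  shows "(M + mat c) ** X = X ** (M + mat c)"
  using assms
  by (simp add: bounded_bilinear.add_left [OF bounded_bilinear_matrix_mult]
        matrix_add_ldistrib mat_mult_eq_cscale mult_mat_eq_cscale)

lemma mpoch_commute:
  fixes M X :: "complex ^ 'd ^ 'd"
  assumes "M ** X = X ** M"
  shows "mpoch M n ** X = X ** mpoch M n"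
proof (induction n)
  case (Suc n)
  have "mpoch M (Suc n) ** X = mpoch M n ** ((M + mat (of_nat n)) ** X)"
    by (simp add: matrix_mul_assoc)
  also have "\<dots> = (mpoch M n ** X) ** (M + mat (of_nat n))"
    by (simp add: commute_add_mat [OF assms] matrix_mul_assoc)
  also have "\<dots> = X ** mpoch M (Suc n)"
    by (simp add: Suc matrix_mul_assoc)
  finally show ?case .
qed simp

lemma invertible_mpoch:
  assumes "\<And>k::nat. invertible (C + mat (of_nat k))"
  shows "invertible (mpoch C n)"
  by (induction n) (auto simp: assms intro!: invertible_mult,
      simp add: invertible_def exI [of _ "mat 1"])

lemma matrix_inv_inverse:
  assumes "invertible X"
  shows "X ** matrix_inv X = mat 1" "matrix_inv X ** X = mat 1"
  using someI_ex [OF assms [unfolded invertible_def]] by (simp_all add: matrix_inv_def)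

lemma add_mat_of_nat: "(M + mat (of_nat m)) + mat (of_nat n) = M + mat (of_nat (m + n))"
  by (simp add: vec_eq_iff mat_def add.assoc)

lemma mpoch_add: "mpoch M (m + n) = mpoch M m ** mpoch (M + mat (of_nat m)) n"
proof (induction n)
  case (Suc n)
  have "mpoch M (m + Suc n) = mpoch M (m + n) ** (M + mat (of_nat (m + n)))"
    by simp
  then show ?case
    by (simp only: Suc mpoch.simps add_mat_of_nat matrix_mul_assoc)
qed simp

text \<open>Both sides are \<open>mpoch M (n + N)\<close>. This identity moves the summation index \<open>n\<close> of the outer
  series out of the shifted parameter of the Horn function.\<close>

lemma mpoch_shift_swap:
  fixes M :: "complex ^ 'd ^ 'd"
  shows "mpoch M n ** mpoch (M + mat (of_nat n)) N = mpoch (M + mat (of_nat N)) n ** mpoch M N"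
proof -
  have "mpoch M n ** mpoch (M + mat (of_nat n)) N = mpoch M N ** mpoch (M + mat (of_nat N)) n"
    using mpoch_add [of M n N] mpoch_add [of M N n] by (simp only: add.commute [of n N])
  also have "\<dots> = mpoch (M + mat (of_nat N)) n ** mpoch M N"
    by (intro mpoch_commute mpoch_commute [symmetric] commute_add_mat [symmetric] refl)
  finally show ?thesis .
qed

section \<open>Growth of Pochhammer symbols and their inverses\<close>

lemma norm_matrix_mult_bound:
  obtains K where "0 < K"
    "\<And>(M :: complex ^ 'd ^ 'd) (N :: complex ^ 'd ^ 'd). norm (M ** N) \<le> K * norm M * norm N"
proof -
  from bounded_bilinear.pos_bounded [OF bounded_bilinear_matrix_mult]
  obtain K where K: "0 < K"
    "\<And>(M :: complex ^ 'd ^ 'd) (N :: complex ^ 'd ^ 'd). norm (M ** N) \<le> norm M * norm N * K"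
    by blast
  have "norm (M ** N) \<le> K * norm M * norm N" for M N :: "complex ^ 'd ^ 'd"
    using K(2) [of M N] by (simp add: mult_ac)
  with K(1) show ?thesis
    by (rule that)
qed

text \<open>\<open>X ** (M + N) = X ** M + N *\<^sub>m X\<close> is a perturbation of \<open>N *\<^sub>m X\<close> by at most
  \<open>\<mu> * norm X\<close>. The upper bound controls Pochhammer symbols; the lower bound controls their
  inverses, because it bounds \<open>X\<close> in terms of \<open>X ** (M + N)\<close>.\<close>

lemma mpoch_norm_step:
  fixes M :: "complex ^ 'd ^ 'd"
  obtains \<mu> where "0 \<le> \<mu>"
    "\<And>(X :: complex ^ 'd ^ 'd) N. norm (X ** (M + mat (of_nat N))) \<le> norm X * (\<mu> + real N)"
    "\<And>(X :: complex ^ 'd ^ 'd) N. norm X * (real N - \<mu>) \<le> norm (X ** (M + mat (of_nat N)))"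
proof -
  obtain K where K: "0 < K" "\<And>(M :: complex ^ 'd ^ 'd) (N :: complex ^ 'd ^ 'd). norm (M ** N) \<le> K * norm M * norm N"
    by (rule norm_matrix_mult_bound) blast
  have eq: "X ** (M + mat (of_nat N)) = X ** M + of_nat N *\<^sub>m X" for X :: "complex ^ 'd ^ 'd" and N
    by (simp add: matrix_add_ldistrib mult_mat_eq_cscale)
  show ?thesis
  proof (rule that [of "K * norm M"])
    fix X :: "complex ^ 'd ^ 'd" and N
    have n: "norm (of_nat N *\<^sub>m X) = real N * norm X" by simp
    show "norm (X ** (M + mat (of_nat N))) \<le> norm X * (K * norm M + real N)"
      using norm_triangle_ineq [of "X ** M" "of_nat N *\<^sub>m X"] K(2) [of X M] n
      unfolding eq by (simp add: algebra_simps)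
    show "norm X * (real N - K * norm M) \<le> norm (X ** (M + mat (of_nat N)))"
      using norm_diff_ineq [of "of_nat N *\<^sub>m X" "X ** M"] K(2) [of X M] n
      unfolding eq by (simp add: algebra_simps)
  qed (use K in auto)
qed

text \<open>The constant \<open>\<mu>\<close> does not depend on the shift \<open>N\<close>. This uniformity lets the matrix series be
  dominated by the scalar binomial series with exponents \<open>- (\<mu> + N)\<close>, whose sums are known.\<close>

lemma norm_mpoch_le_pochhammer:
  fixes M :: "complex ^ 'd ^ 'd"
  obtains \<mu> where "0 \<le> \<mu>"
    "\<And>N n. norm (mpoch (M + mat (of_nat N)) n)
       \<le> norm (mat 1 :: complex ^ 'd ^ 'd) * pochhammer (\<mu> + real N) n"
proof -
  obtain \<mu> where \<mu>: "0 \<le> \<mu>"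
    "\<And>(X :: complex ^ 'd ^ 'd) N. norm (X ** (M + mat (of_nat N))) \<le> norm X * (\<mu> + real N)"
    by (metis mpoch_norm_step)
  show ?thesis
  proof (rule that [OF \<mu>(1)])
    fix N n
    show "norm (mpoch (M + mat (of_nat N)) n)
       \<le> norm (mat 1 :: complex ^ 'd ^ 'd) * pochhammer (\<mu> + real N) n"
    proof (induction n)
      case (Suc n)
      have "M + mat (of_nat N) + mat (of_nat n) = M + mat (of_nat (N + n))"
        by (simp add: vec_eq_iff mat_def)
      then have "norm (mpoch (M + mat (of_nat N)) (Suc n))
          \<le> norm (mpoch (M + mat (of_nat N)) n) * (\<mu> + real (N + n))"
        using \<mu>(2) [of "mpoch (M + mat (of_nat N)) n" "N + n"] by (simp only: mpoch.simps)
      also have "\<dots> \<le> norm (mat 1 :: complex ^ 'd ^ 'd) * pochhammer (\<mu> + real N) n * (\<mu> + real (N + n))"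
        using Suc \<mu>(1) by (intro mult_right_mono) auto
      finally show ?case by (simp add: pochhammer_Suc algebra_simps)
    qed simp
  qed
qed

lemma eventually_mono_decreasing_bounded:
  fixes g :: "nat \<Rightarrow> real"
  assumes "eventually (\<lambda>n. g (Suc n) \<le> g n) sequentially"
  obtains K where "0 < K" "\<And>n. g n \<le> K"
proof -
  obtain n0 where n0: "\<And>n. n0 \<le> n \<Longrightarrow> g (Suc n) \<le> g n"
    using assms by (auto simp: eventually_sequentially)
  have ub: "g n \<le> Max (g ` {..n0})" if "n \<le> n0" for n
    using that by auto
  have "g n \<le> g n0" if "n0 \<le> n" for n
    using that by (induction rule: dec_induct) (use n0 order_trans in blast)+
  then have "g n \<le> Max (g ` {..n0})" for n
    using ub [of n] ub [of n0] by (cases "n \<le> n0") (force, meson le_refl nat_le_linear order_trans)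
  then have "g n \<le> \<bar>Max (g ` {..n0})\<bar> + 1" for n
    by (rule order_trans) linarith
  then show ?thesis
    by (intro that [of "\<bar>Max (g ` {..n0})\<bar> + 1"]) auto
qed

text \<open>Consecutive values of \<open>norm (mpoch M n) / (q ^ n * fact n)\<close> have ratio at most
  \<open>(\<mu> + n) / (q * (n + 1))\<close>, which is eventually below \<open>1\<close>. An arbitrary geometric factor \<open>q ^ n\<close> in
  place of a power of \<open>n\<close> is enough, as the domain of convergence is open.\<close>

lemma norm_mpoch_le_fact:
  fixes M :: "complex ^ 'd ^ 'd"
  assumes "1 < q"
  obtains K where "0 < K" "\<And>n. norm (mpoch M n) \<le> K * q ^ n * fact n"
proof -
  obtain \<mu> where \<mu>: "0 \<le> \<mu>"
    "\<And>(X :: complex ^ 'd ^ 'd) N. norm (X ** (M + mat (of_nat N))) \<le> norm X * (\<mu> + real N)"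
    by (metis mpoch_norm_step)
  have q: "q > 0" using assms by simp
  define g where "g n = norm (mpoch M n) / (q ^ n * fact n)" for n
  \<comment> \<open>This bound is \<open>\<mu> + n \<le> q * (n + 1)\<close> solved for \<open>n\<close>.\<close>
  have "eventually (\<lambda>n. (\<mu> - q) / (q - 1) \<le> real n) sequentially"
    by real_asymp
  then have "eventually (\<lambda>n. g (Suc n) \<le> g n) sequentially"
  proof eventually_elim
    case (elim n)
    then have *: "\<mu> + real n \<le> q * (real n + 1)"
      using assms by (simp add: field_simps)
    have "norm (mpoch M (Suc n)) \<le> norm (mpoch M n) * (q * (real n + 1))"
      using \<mu>(2) [of "mpoch M n" n] mult_left_mono [OF *, of "norm (mpoch M n)"] by simp
    then show ?case
      using q by (simp add: g_def divide_simps del: mpoch.simps) (simp add: algebra_simps)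
  qed
  then obtain K where "0 < K" "\<And>n. g n \<le> K"
    by (rule eventually_mono_decreasing_bounded) blast
  then show ?thesis
    using q by (intro that [of K]) (auto simp: g_def divide_simps mult_ac)
qed

text \<open>The inverses \<open>X n\<close> of \<open>mpoch C n\<close> satisfy \<open>X (Suc n) ** (C + n) = X n\<close>, so the lower bound in
  \<open>mpoch_norm_step\<close> gives \<open>norm (X (Suc n)) * (n - \<mu>) \<le> norm (X n)\<close>, and the ratio argument applies
  again.\<close>

lemma norm_matrix_inv_mpoch_le_fact:
  fixes C :: "complex ^ 'd ^ 'd"
  assumes inv: "\<And>k::nat. invertible (C + mat (of_nat k))" and "1 < q"
  obtains K where "0 < K" "\<And>n. norm (matrix_inv (mpoch C n)) \<le> K * q ^ n / fact n"
proof -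
  define X where "X n = matrix_inv (mpoch C n)" for n
  have X: "X (Suc n) ** (C + mat (of_nat n)) = X n" for n
  proof -
    have "X (Suc n) ** (C + mat (of_nat n)) =
        X (Suc n) ** ((C + mat (of_nat n)) ** (mpoch C n ** X n))"
      by (simp add: X_def matrix_inv_inverse invertible_mpoch inv)
    also have "\<dots> = X (Suc n) ** (((C + mat (of_nat n)) ** mpoch C n) ** X n)"
      by (simp only: matrix_mul_assoc)
    also have "(C + mat (of_nat n)) ** mpoch C n = mpoch C (Suc n)"
      using mpoch_commute [of C "C + mat (of_nat n)" n] commute_add_mat [of C C "of_nat n"] by simp
    also have "X (Suc n) ** (mpoch C (Suc n) ** X n) = (X (Suc n) ** mpoch C (Suc n)) ** X n"
      by (simp only: matrix_mul_assoc)
    also have "\<dots> = X n"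
      by (simp add: X_def matrix_inv_inverse invertible_mpoch inv del: mpoch.simps)
    finally show ?thesis .
  qed
  obtain \<mu> where \<mu>: "0 \<le> \<mu>"
    "\<And>(X :: complex ^ 'd ^ 'd) N. norm X * (real N - \<mu>) \<le> norm (X ** (C + mat (of_nat N)))"
    by (metis mpoch_norm_step)
  have q: "q > 0" using assms by simp
  define g where "g n = norm (X n) * fact n / q ^ n" for n
  \<comment> \<open>This bound is \<open>n + 1 \<le> q * (n - \<mu>)\<close> solved for \<open>n\<close>.\<close>
  have "eventually (\<lambda>n. (q * \<mu> + 1) / (q - 1) \<le> real n) sequentially"
    by real_asymp
  then have "eventually (\<lambda>n. g (Suc n) \<le> g n) sequentially"
  proof eventually_elim
    case (elim n)
    then have *: "real n + 1 \<le> q * (real n - \<mu>)"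
      using assms by (simp add: field_simps)
    have "norm (X (Suc n)) * (real n + 1) \<le> norm (X (Suc n)) * (q * (real n - \<mu>))"
      using * by (intro mult_left_mono) auto
    also have "\<dots> \<le> q * norm (X n)"
      using \<mu>(2) [of "X (Suc n)" n] q by (simp add: X mult_ac)
    finally have "norm (X (Suc n)) * (real n + 1) * (fact n * q ^ n)
        \<le> q * norm (X n) * (fact n * q ^ n)"
      using q by (intro mult_right_mono) auto
    then show ?case
      using q by (simp add: g_def field_simps)
  qed
  then obtain K where K: "0 < K" "\<And>n. g n \<le> K"
    by (rule eventually_mono_decreasing_bounded) blast
  have "norm (X n) \<le> K * q ^ n / fact n" for n
    using K(2) [of n] q by (simp add: g_def field_simps)
  with K(1) show ?thesis
    by (intro that [of K]) (auto simp: X_def)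
qed

section \<open>The binomial series of a matrix\<close>

lemma pochhammer_sums_powr:
  fixes a r :: real
  assumes "0 \<le> r" "r < 1"
  shows "(\<lambda>n. pochhammer a n / fact n * r ^ n) sums (1 - r) powr (- a)"
proof -
  have "(\<lambda>n. (- a gchoose n) * (- r) ^ n) sums (1 + - r) powr (- a)"
    using assms by (intro gen_binomial_real) auto
  moreover have "(- a gchoose n) * (- r) ^ n = pochhammer a n / fact n * r ^ n" for n
    by (simp add: gbinomial_pochhammer power_mult_distrib [symmetric])
  ultimately show ?thesis by simp
qed

lemma one_minus_pow_neg_sums:
  fixes M :: "complex ^ 'd ^ 'd"
  assumes "norm t < 1"
  shows "(\<lambda>n. (t ^ n / fact n) *\<^sub>m mpoch M n) sums one_minus_pow_neg t M"
proof -
  obtain \<mu> where \<mu>: "0 \<le> \<mu>" "\<And>N n. norm (mpoch (M + mat (of_nat N)) n)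
       \<le> norm (mat 1 :: complex ^ 'd ^ 'd) * pochhammer (\<mu> + real N) n"
    by (rule norm_mpoch_le_pochhammer) blast
  let ?I = "norm (mat 1 :: complex ^ 'd ^ 'd)"
  have "summable (\<lambda>n. (t ^ n / fact n) *\<^sub>m mpoch M n)"
  proof (rule summable_comparison_test')
    show "summable (\<lambda>n. ?I * (pochhammer \<mu> n / fact n * norm t ^ n))"
      using assms by (intro summable_mult sums_summable [OF pochhammer_sums_powr]) auto
    show "norm ((t ^ n / fact n) *\<^sub>m mpoch M n) \<le> ?I * (pochhammer \<mu> n / fact n * norm t ^ n)" for n
      using mult_left_mono [OF \<mu>(2) [of 0 n], of "norm t ^ n / fact n"]
      by (simp add: norm_divide norm_power mult_ac)
  qed
  then show ?thesis
    unfolding one_minus_pow_neg_def by (rule summable_sums)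
qed

text \<open>The law \<open>(1 - t) * (1 - t)\<^bsup>-(M + 1)\<^esup> = (1 - t)\<^bsup>-M\<^esup>\<close> comes out of the coefficients of the binomial
  series: \<open>mpoch M (Suc n) = mpoch (M + 1) (Suc n) - (n + 1) * mpoch (M + 1) n\<close>, since the last
  factor \<open>M + 1 + n\<close> of \<open>mpoch (M + 1) (Suc n)\<close> exceeds \<open>n + 1\<close> by \<open>M\<close>.\<close>

lemma one_minus_pow_neg_add_one:
  fixes M :: "complex ^ 'd ^ 'd"
  assumes "norm t < 1"
  shows "one_minus_pow_neg t M = (1 - t) *\<^sub>m one_minus_pow_neg t (M + mat (of_nat 1))"
proof -
  define P where "P = mpoch (M + mat (of_nat 1))"
  define f where "f n = (t ^ n / fact n) *\<^sub>m P n" for n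
  let ?S = "one_minus_pow_neg t (M + mat (of_nat 1))"
  have f: "f sums ?S"
    unfolding f_def P_def by (rule one_minus_pow_neg_sums [OF assms])
  have step: "(t ^ Suc n / fact (Suc n)) *\<^sub>m mpoch M (Suc n) = f (Suc n) - t *\<^sub>m f n" for n
  proof -
    have "mpoch M (Suc n) = mpoch M 1 ** P n"
      using mpoch_add [of M 1 n] by (simp add: P_def)
    also have "\<dots> = P n ** M"
      using mpoch_commute [of "M + mat (of_nat 1)" M n] commute_add_mat [of M M "of_nat 1"]
      by (simp add: P_def)
    finally have "mpoch M (Suc n) = P (Suc n) - of_nat (Suc n) *\<^sub>m P n"
      unfolding P_def mpoch.simps add_mat_of_nat
      by (simp only: matrix_add_ldistrib mult_mat_eq_cscale) simp
    moreover have "t ^ Suc n / fact (Suc n) * of_nat (Suc n) = t * (t ^ n / fact n)"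
      by (simp del: of_nat_Suc)
    ultimately show ?thesis
      by (simp only: f_def cscale_diff_right cscale_cscale)
  qed
  have "(\<lambda>n. f (Suc n) - t *\<^sub>m f n) sums (?S - f 0 - t *\<^sub>m ?S)"
    using f by (intro sums_diff bounded_linear.sums [OF bounded_linear_cscale]) (simp_all add: sums_Suc_iff)
  then have "(\<lambda>n. (t ^ n / fact n) *\<^sub>m mpoch M n) sums (?S - f 0 - t *\<^sub>m ?S + mpoch M 0)"
    unfolding step [symmetric] by (subst (asm) sums_Suc_iff) simp
  moreover have "?S - f 0 - t *\<^sub>m ?S + mpoch M 0 = (1 - t) *\<^sub>m ?S"
    by (simp add: f_def P_def vec_eq_iff algebra_simps)
  ultimately show ?thesis
    using sums_unique2 [OF one_minus_pow_neg_sums [OF assms, of M]] by simp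
qed

lemma one_minus_pow_neg_add_nat:
  fixes M :: "complex ^ 'd ^ 'd"
  assumes "norm t < 1"
  shows "one_minus_pow_neg t (M + mat (of_nat N)) = ((1 / (1 - t)) ^ N) *\<^sub>m one_minus_pow_neg t M"
proof (induction N)
  case (Suc N)
  have "t \<noteq> 1" using assms by auto
  have "(1 / (1 - t)) *\<^sub>m one_minus_pow_neg t (M + mat (of_nat N)) =
      one_minus_pow_neg t (M + mat (of_nat (Suc N)))"
    using \<open>t \<noteq> 1\<close> one_minus_pow_neg_add_one [OF assms, of "M + mat (of_nat N)"]
    unfolding add_mat_of_nat by simp
  then show ?case
    by (simp add: Suc)
qed (simp)

text \<open>For \<open>c \<noteq> 0\<close> the families \<open>f\<close> and \<open>c *\<^sub>m f\<close> are both summable or both not summable. In the latter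
  case, and for \<open>c = 0\<close>, both sides are \<open>0\<close>.\<close>

lemma infsum_cscale: "infsum (\<lambda>i. c *\<^sub>m f i) A = c *\<^sub>m infsum f A"
proof (rule infsum_bounded_linear_strong' [where mult = "(*\<^sub>m)"])
  assume "c \<noteq> 0"
  then show "(\<lambda>x. c *\<^sub>m f x) summable_on A \<longleftrightarrow> f summable_on A"
    by (intro summable_on_bounded_linear_iff [where h' = "(*\<^sub>m) (inverse c)"] bounded_linear_cscale) simp
qed (auto simp: bounded_linear_cscale vec_eq_iff)

text \<open>Expanding \<open>(1 - t)\<^bsup>-(M + \<nu> i)\<^esup> = (1 - t)\<^bsup>-M\<^esup> * (1 - t)\<^bsup>-\<nu> i\<^esup>\<close> on the right in powers of \<open>t\<close> produces
  the left side after the sums over \<open>i\<close> and \<open>n\<close> are exchanged. The exchange is justified by absolute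
  convergence: the norms of the terms with fixed \<open>i\<close> sum to at most a constant times
  \<open>norm (b i) * (1 - norm t) powr - (\<mu> + \<nu> i)\<close>.\<close>

lemma one_minus_pow_neg_mult_infsum_local:
  fixes M :: "complex ^ 'd ^ 'd" and b :: "'i \<Rightarrow> complex ^ 'd ^ 'd" and \<nu> :: "'i \<Rightarrow> nat"
  assumes t: "norm t < 1"
    and summ: "(\<lambda>i. norm (b i) * (1 / (1 - norm t)) ^ \<nu> i) summable_on UNIV"
  shows "(\<lambda>n. (t ^ n / fact n) *\<^sub>m (\<Sum>\<^sub>\<infinity>i. mpoch (M + mat (of_nat (\<nu> i))) n ** b i)) sums
    (one_minus_pow_neg t M ** (\<Sum>\<^sub>\<infinity>i. (1 / (1 - t)) ^ \<nu> i *\<^sub>m b i))"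
proof -
  define r where "r = norm t"
  have r: "0 \<le> r" "r < 1" using t by (auto simp: r_def)
  define T where "T i n = (t ^ n / fact n) *\<^sub>m (mpoch (M + mat (of_nat (\<nu> i))) n ** b i)" for i n
  obtain \<mu> where \<mu>: "0 \<le> \<mu>" "\<And>N n. norm (mpoch (M + mat (of_nat N)) n)
       \<le> norm (mat 1 :: complex ^ 'd ^ 'd) * pochhammer (\<mu> + real N) n"
    by (rule norm_mpoch_le_pochhammer) blast
  obtain K where K: "0 < K"
    "\<And>(M :: complex ^ 'd ^ 'd) (N :: complex ^ 'd ^ 'd). norm (M ** N) \<le> K * norm M * norm N"
    by (rule norm_matrix_mult_bound) blast
  let ?I = "norm (mat 1 :: complex ^ 'd ^ 'd)"
  define g where "g i n = K * ?I * norm (b i) * (pochhammer (\<mu> + real (\<nu> i)) n / fact n * r ^ n)" for i n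
  have T_le: "norm (T i n) \<le> g i n" for i n
  proof -
    have "norm (mpoch (M + mat (of_nat (\<nu> i))) n ** b i)
        \<le> K * (?I * pochhammer (\<mu> + real (\<nu> i)) n) * norm (b i)"
      using K(1) \<mu>(2) by (intro order_trans [OF K(2)] mult_right_mono mult_left_mono) auto
    then have "r ^ n / fact n * norm (mpoch (M + mat (of_nat (\<nu> i))) n ** b i)
        \<le> r ^ n / fact n * (K * (?I * pochhammer (\<mu> + real (\<nu> i)) n) * norm (b i))"
      using r by (intro mult_left_mono) auto
    then show ?thesis
      by (simp add: T_def g_def norm_divide norm_power r_def mult_ac)
  qed
  have g_nonneg: "0 \<le> g i n" for i n
    using order_trans [OF norm_ge_zero T_le] .
  have g_sums: "g i sums (K * ?I * (1 - r) powr (- \<mu>) * (norm (b i) * (1 / (1 - r)) ^ \<nu> i))" for i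
  proof -
    have "g i sums (K * ?I * norm (b i) * (1 - r) powr (- (\<mu> + real (\<nu> i))))"
      unfolding g_def by (intro sums_mult pochhammer_sums_powr r)
    also have "(1 - r) powr (- (\<mu> + real (\<nu> i))) = (1 - r) powr (- \<mu>) * (1 / (1 - r)) ^ \<nu> i"
      using r by (simp add: powr_diff powr_realpow power_divide)
    finally show ?thesis
      by (simp add: mult_ac)
  qed
  have "(\<lambda>(i, n). g i n) summable_on UNIV \<times> UNIV"
  proof (rule summable_on_SigmaI)
    show "((\<lambda>n. case (i, n) of (i, n) \<Rightarrow> g i n) has_sum
        (K * ?I * (1 - r) powr (- \<mu>) * (norm (b i) * (1 / (1 - r)) ^ \<nu> i))) UNIV" for i
      using g_sums g_nonneg by (simp add: sums_nonneg_imp_has_sum)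
    show "(\<lambda>i. K * ?I * (1 - r) powr (- \<mu>) * (norm (b i) * (1 / (1 - r)) ^ \<nu> i)) summable_on UNIV"
      using summ by (intro summable_on_cmult_right) (simp add: r_def)
  qed (use g_nonneg in auto)
  then have abs: "(\<lambda>p. norm (case p of (i, n) \<Rightarrow> T i n)) summable_on UNIV \<times> UNIV"
    by (rule summable_on_comparison_test) (use T_le in auto)
  then have T_summ: "(\<lambda>(i, n). T i n) summable_on UNIV \<times> UNIV"
    by (rule abs_summable_summable)
  have T_summ': "(\<lambda>(n, i). T i n) summable_on UNIV \<times> UNIV"
    using T_summ by (subst (asm) product_swap [symmetric], subst (asm) summable_on_reindex)
      (auto simp: o_def case_prod_unfold)
  have inner: "infsum (T i) UNIV = one_minus_pow_neg t M ** ((1 / (1 - t)) ^ \<nu> i *\<^sub>m b i)" for i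
  proof -
    have T_sums: "T i sums (one_minus_pow_neg t (M + mat (of_nat (\<nu> i))) ** b i)"
      unfolding T_def cscale_mult_left [symmetric]
      by (intro bounded_linear.sums [OF bounded_bilinear.bounded_linear_left [OF bounded_bilinear_matrix_mult]]
          one_minus_pow_neg_sums t)
    have "summable (\<lambda>n. norm (T i n))"
      using T_le by (intro summable_comparison_test' [OF sums_summable [OF g_sums]]) auto
    then have "infsum (T i) UNIV = one_minus_pow_neg t (M + mat (of_nat (\<nu> i))) ** b i"
      using T_sums by (intro infsumI norm_summable_imp_has_sum)
    then show ?thesis
      by (simp only: one_minus_pow_neg_add_nat [OF t] cscale_mult_left cscale_mult_right)
  qed
  have b_summ: "(\<lambda>i. (1 / (1 - t)) ^ \<nu> i *\<^sub>m b i) summable_on UNIV"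
  proof (rule abs_summable_summable, rule summable_on_comparison_test [OF summ])
    show "norm ((1 / (1 - t)) ^ \<nu> i *\<^sub>m b i) \<le> norm (b i) * (1 / (1 - norm t)) ^ \<nu> i" for i
    proof -
      have "1 - norm t \<le> norm (1 - t)"
        using norm_triangle_ineq2 [of 1 t] by simp
      then have "norm (1 / (1 - t)) \<le> 1 / (1 - norm t)"
        using t by (auto simp: norm_divide intro!: divide_left_mono mult_pos_pos)
      then have "norm (1 / (1 - t)) ^ \<nu> i \<le> (1 / (1 - norm t)) ^ \<nu> i"
        by (intro power_mono) auto
      then show ?thesis
        by (simp only: norm_cscale norm_power) (simp add: mult.commute mult_left_mono del: norm_divide)
    qed
  qed auto
  have "((\<lambda>n. infsum (\<lambda>i. T i n) UNIV) has_sum infsum (\<lambda>n. infsum (\<lambda>i. T i n) UNIV) UNIV) UNIV"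
    by (intro has_sum_infsum summable_on_Sigma_banach T_summ')
  also have "infsum (\<lambda>n. infsum (\<lambda>i. T i n) UNIV) UNIV = infsum (\<lambda>i. infsum (T i) UNIV) UNIV"
    by (rule infsum_swap_banach [OF T_summ'])
  also have "\<dots> = one_minus_pow_neg t M ** (\<Sum>\<^sub>\<infinity>i. (1 / (1 - t)) ^ \<nu> i *\<^sub>m b i)"
    unfolding inner
    by (intro infsumI has_sum_bounded_linear
        [OF bounded_bilinear.bounded_linear_right [OF bounded_bilinear_matrix_mult]] has_sum_infsum b_summ)
  finally show ?thesis
    by (intro has_sum_imp_sums) (simp add: T_def infsum_cscale)
qed

section \<open>Abel summation and continuation in a lune\<close>

text \<open>Abel's limit theorem on the radius. With \<open>d n\<close> the error of the partial sums, summation by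
  parts turns the difference from \<open>L\<close> into \<open>(1 - r) * (\<Sum>n. d n * r ^ n)\<close>: finitely many \<open>d n\<close> are
  killed by the factor \<open>1 - r\<close>, and the small ones contribute a small multiple of
  \<open>(1 - r) * (\<Sum>n. r ^ n) = 1\<close>.\<close>

lemma abel_radial_limit:
  fixes c :: "nat \<Rightarrow> complex"
  assumes "c sums L"
  shows "((\<lambda>r. \<Sum>n. c n * of_real r ^ n) \<longlongrightarrow> L) (at_left (1::real))"
proof -
  define d where "d n = (\<Sum>k\<le>n. c k) - L" for n
  have "(\<lambda>n. \<Sum>k\<le>n. c k) \<longlonglongrightarrow> L"
    using assms by (simp add: sums_def_le)
  then have d: "d \<longlonglongrightarrow> 0"
    unfolding d_def by (simp add: LIM_zero)
  then have "Bseq d"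
    by (intro Bseq_eq_bounded convergent_imp_Bseq) (auto simp: convergent_def)
  then obtain B where B: "\<And>n. norm (d n) \<le> B"
    by (auto simp: Bseq_def)
  have summ_d: "summable (\<lambda>n. norm (d n) * r ^ n)" if "0 \<le> r" "r < 1" for r :: real
    by (rule summable_comparison_test' [where g = "\<lambda>n. B * r ^ n"])
       (use that B in \<open>auto intro!: summable_mult summable_geometric mult_right_mono\<close>)
  have eq: "(\<Sum>n. c n * of_real r ^ n) - L = of_real (1 - r) * (\<Sum>n. d n * of_real r ^ n)"
    if r: "0 < r" "r < 1" for r :: real
  proof -
    have D: "summable (\<lambda>n. d n * of_real r ^ n)"
      by (rule summable_norm_cancel) (use summ_d [of r] r in \<open>auto simp: norm_mult norm_power\<close>)
    let ?D = "\<Sum>n. d n * of_real r ^ n"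
    have 1: "(\<lambda>n. d (Suc n) * of_real r ^ Suc n) sums (?D - d 0)"
      using summable_sums [OF D] by (subst sums_Suc_iff) simp
    have 2: "(\<lambda>n. of_real r * (d n * of_real r ^ n)) sums (of_real r * ?D)"
      by (intro sums_mult summable_sums D)
    have "(\<lambda>n. c (Suc n) * of_real r ^ Suc n) sums (?D - d 0 - of_real r * ?D)"
      using sums_diff [OF 1 2] by (simp add: d_def algebra_simps)
    then have "(\<lambda>n. c n * of_real r ^ n) sums (?D - d 0 - of_real r * ?D + c 0)"
      by (subst (asm) sums_Suc_iff) simp
    then show ?thesis
      by (simp add: sums_iff d_def algebra_simps)
  qed
  have "((\<lambda>r. (\<Sum>n. c n * of_real r ^ n) - L) \<longlongrightarrow> 0) (at_left (1::real))"
  proof (rule tendstoI)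
    fix e :: real assume "0 < e"
    then obtain N where N: "\<And>n. N \<le> n \<Longrightarrow> norm (d n) < e / 2"
      using LIMSEQ_D [OF d, of "e / 2"] by auto
    define C where "C = (\<Sum>n<N. norm (d n))"
    have "C \<ge> 0" by (simp add: C_def sum_nonneg)
    have bnd: "norm ((\<Sum>n. c n * of_real r ^ n) - L) \<le> (1 - r) * C + e / 2"
      if r: "0 < r" "r < 1" for r :: real
    proof -
      have le: "norm (d n) * r ^ n \<le> (if n < N then norm (d n) else 0) + e / 2 * r ^ n" for n
        using r N [of n] \<open>0 < e\<close>
        by (auto intro!: mult_right_mono add_increasing2 mult_left_le simp: power_le_one not_less)
      have "(\<lambda>n. if n \<in> {..<N} then norm (d n) else 0) sums C"
        unfolding C_def by (intro sums_If_finite_set) auto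
      moreover have "(\<lambda>n. e / 2 * r ^ n) sums (e / 2 * (1 / (1 - r)))"
        using r by (intro sums_mult geometric_sums) auto
      ultimately have s: "(\<lambda>n. (if n < N then norm (d n) else 0) + e / 2 * r ^ n)
          sums (C + e / 2 * (1 / (1 - r)))"
        using sums_add by force
      have "norm (\<Sum>n. d n * of_real r ^ n) \<le> (\<Sum>n. norm (d n * of_real r ^ n))"
        using summ_d [of r] r by (intro summable_norm) (auto simp: norm_mult norm_power)
      also have "\<dots> = (\<Sum>n. norm (d n) * r ^ n)"
        using r by (simp add: norm_mult norm_power)
      also have "\<dots> \<le> C + e / 2 * (1 / (1 - r))"
        using suminf_le [OF le summ_d sums_summable [OF s]] r sums_unique [OF s] by simp
      finally have "(1 - r) * norm (\<Sum>n. d n * of_real r ^ n)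
          \<le> (1 - r) * (C + e / 2 * (1 / (1 - r)))"
        using r by (intro mult_left_mono) auto
      also have "\<dots> = (1 - r) * C + e / 2"
        using r by (simp add: field_simps)
      finally show ?thesis
        using r by (simp add: eq norm_mult del: of_real_diff)
    qed
    have "((\<lambda>r. (1 - r) * C) \<longlongrightarrow> (1 - 1) * C) (at_left (1::real))"
      by (intro tendsto_intros)
    then have "eventually (\<lambda>r. (1 - r) * C < e / 2) (at_left (1::real))"
      by (rule order_tendstoD) (use \<open>0 < e\<close> in auto)
    moreover have "eventually (\<lambda>r::real. r \<in> {0<..<1}) (at_left 1)"
      by (rule eventually_at_left_real) auto
    ultimately show "eventually (\<lambda>r. dist ((\<Sum>n. c n * of_real r ^ n) - L) 0 < e) (at_left (1::real))"
    proof eventually_elim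
      case (elim r)
      then show ?case using bnd [of r] by (simp add: dist_norm)
    qed
  qed
  then show ?thesis by (simp add: LIM_zero_iff)
qed


text \<open>If the discs overlap, the region is a lune, and the segment from \<open>0\<close> to one of its points can
  cross the removed disc. Instead a point is first rotated about \<open>0\<close> to the negative real axis, which
  keeps its modulus and does not decrease its distance from \<open>1\<close>, and then moved along the axis to \<open>0\<close>.\<close>

lemma connected_ball_minus_cball:
  fixes R s :: real
  assumes R: "0 < R" and s: "s < 1"
  shows "connected (ball 0 R - cball 1 s :: complex set)"
proof -
  let ?S = "ball 0 R - cball 1 s :: complex set"
  have "connected_component ?S u 0" if u: "u \<in> ?S" for u
  proof -
    define \<rho> \<phi> where "\<rho> = norm u" and "\<phi> = Arg (- u)"
    have u_eq: "u = - of_real \<rho> * cis \<phi>"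
      using rcis_cmod_Arg [of "- u"] by (simp add: \<rho>_def \<phi>_def rcis_def minus_equation_iff)
    have \<phi>: "\<bar>\<phi>\<bar> \<le> pi"
      using Arg_bounded [of "- u"] by (auto simp: \<phi>_def)
    have dist: "(dist 1 (- of_real \<rho> * cis a))\<^sup>2 = 1 + \<rho>\<^sup>2 + 2 * \<rho> * cos a" for a
    proof -
      have "(dist 1 (- of_real \<rho> * cis a))\<^sup>2 = (1 + \<rho> * cos a)\<^sup>2 + (\<rho> * sin a)\<^sup>2"
        by (simp add: dist_norm cmod_power2)
      also have "\<dots> = 1 + \<rho>\<^sup>2 * ((sin a)\<^sup>2 + (cos a)\<^sup>2) + 2 * \<rho> * cos a"
        by algebra
      finally show ?thesis by (simp only: sin_cos_squared_add mult_1_right)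
    qed
    define P where "P = (\<lambda>a. - of_real \<rho> * cis (a * \<phi>)) ` {0..1::real}"
    have "connected P"
      unfolding P_def
      by (intro connected_continuous_image continuous_intros connected_Icc)
    moreover have "P \<subseteq> ?S"
    proof -
      have "- of_real \<rho> * cis (a * \<phi>) \<in> ?S" if a: "0 \<le> a" "a \<le> 1" for a
      proof -
        have "\<bar>a * \<phi>\<bar> \<le> \<bar>\<phi>\<bar>"
          using a by (auto simp: abs_mult intro: mult_left_le_one_le)
        then have "cos \<bar>\<phi>\<bar> \<le> cos \<bar>a * \<phi>\<bar>"
          using \<phi> by (intro cos_monotone_0_pi_le) auto
        then have "cos \<phi> \<le> cos (a * \<phi>)"
          by simp
        then have "(dist 1 u)\<^sup>2 \<le> (dist 1 (- of_real \<rho> * cis (a * \<phi>)))\<^sup>2"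
          unfolding dist by (subst u_eq, subst dist) (auto simp: \<rho>_def intro: mult_left_mono)
        then have "dist 1 u \<le> dist 1 (- of_real \<rho> * cis (a * \<phi>))"
          by (rule power2_le_imp_le) auto
        with u show ?thesis
          by (auto simp: norm_mult \<rho>_def)
      qed
      then show ?thesis by (auto simp: P_def)
    qed
    moreover have "u \<in> P" "- of_real \<rho> \<in> P"
      using u_eq by (auto simp: P_def image_iff intro: bexI [of _ 1] bexI [of _ 0])
    ultimately have 1: "connected_component ?S u (- of_real \<rho>)"
      unfolding connected_component_def by blast
    have "closed_segment (- of_real \<rho>) (0::complex) \<subseteq> ?S"
    proof
      fix z :: complex assume "z \<in> closed_segment (- of_real \<rho>) 0"
      then obtain a where a: "0 \<le> a" "a \<le> 1" "z = (1 - a) *\<^sub>R (- of_real \<rho>)"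
        by (auto simp: in_segment)
      have z: "z = - of_real ((1 - a) * \<rho>)"
        using a by (simp add: scaleR_conv_of_real)
      have b: "0 \<le> (1 - a) * \<rho>" "(1 - a) * \<rho> \<le> \<rho>"
        using a by (auto simp: \<rho>_def intro: mult_left_le_one_le)
      have "dist 1 z = norm (of_real (1 + (1 - a) * \<rho>) :: complex)"
        unfolding z dist_norm by simp
      also have "\<dots> = 1 + (1 - a) * \<rho>"
        using b by (subst norm_of_real) auto
      finally have "1 \<le> dist 1 z" using b by simp
      moreover have "norm z \<le> \<rho>"
        unfolding z norm_minus_cancel norm_of_real using b by simp
      ultimately show "z \<in> ?S"
        using u s by (auto simp: \<rho>_def)
    qed
    then have 2: "connected_component ?S (- of_real \<rho>) 0"
      unfolding connected_component_def
      by (intro exI [of _ "closed_segment (- of_real \<rho>) (0::complex)"]) auto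
    show ?thesis
      using 1 2 by (rule connected_component_trans)
  qed
  then show ?thesis
    unfolding connected_iff_connected_component
    by (meson connected_component_sym connected_component_trans)
qed

text \<open>Convergence at \<open>t\<close> alone makes the power series holomorphic in the disc of radius \<open>norm t\<close>. There
  it agrees with \<open>g\<close> near \<open>0\<close>, hence on the whole lune by the identity theorem. The lune contains
  \<open>r * t\<close> for \<open>r\<close> just below \<open>1\<close>, so the value at the boundary point \<open>t\<close> is reached by continuity of
  \<open>g\<close> on one side and Abel's theorem on the other.\<close>

lemma sums_continuation:
  fixes a :: "nat \<Rightarrow> complex" and g :: "complex \<Rightarrow> complex"
  assumes s: "0 \<le> s" "s < 1"
    and hol: "g holomorphic_on (ball 0 1 - cball 1 s)"
    and loc: "\<And>u. norm u < 1 - s \<Longrightarrow> (\<lambda>n. a n * u ^ n) sums g u"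
    and t: "t \<in> ball 0 1 - cball 1 s"
    and summ: "summable (\<lambda>n. a n * t ^ n)"
  shows "(\<lambda>n. a n * t ^ n) sums g t"
proof (cases "t = 0")
  case True
  then show ?thesis using loc [of t] s by simp
next
  case False
  define R where "R = norm t"
  have R: "0 < R" "R < 1"
    using False t by (auto simp: R_def)
  define f where "f u = (\<Sum>n. a n * u ^ n)" for u
  let ?S = "ball 0 R - cball 1 s :: complex set"
  have f_sums: "(\<lambda>n. a n * (u - 0) ^ n) sums f u" if "u \<in> ball 0 R" for u
    using powser_inside [OF summ, of u] that by (auto simp: R_def f_def summable_sums)
  have f_hol: "f holomorphic_on ball 0 R"
    by (rule power_series_holomorphic [OF f_sums])
  have near: "ball 0 (min R (1 - s)) \<subseteq> ?S"
  proof
    fix u :: complex assume u: "u \<in> ball 0 (min R (1 - s))"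
    have "1 - norm u \<le> dist 1 u"
      using norm_triangle_ineq2 [of 1 u] by (simp add: dist_norm)
    with u show "u \<in> ?S" by auto
  qed
  have eq: "f u = g u" if "u \<in> ?S" for u
  proof (rule analytic_continuation_open [where f = f and g = g, OF _ _ _ _ near])
    show "connected ?S"
      using R s by (intro connected_ball_minus_cball) auto
    show "f holomorphic_on ?S"
      using f_hol by (rule holomorphic_on_subset) auto
    show "g holomorphic_on ?S"
      using hol by (rule holomorphic_on_subset) (use R in auto)
    show "f z = g z" if "z \<in> ball 0 (min R (1 - s))" for z
      using loc [of z] that by (simp add: f_def sums_iff)
  qed (use that R s in \<open>auto intro!: open_Diff\<close>)
  have lim: "((\<lambda>r. of_real r * t) \<longlongrightarrow> of_real 1 * t) (at_left (1::real))"
    by (intro tendsto_intros)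
  have op: "open (ball 0 1 - cball 1 s :: complex set)"
    by (intro open_Diff) auto
  have "eventually (\<lambda>r. of_real r * t \<in> - cball 1 s) (at_left (1::real))"
    using topological_tendstoD [OF lim, of "- cball 1 s"] t by auto
  moreover have "eventually (\<lambda>r::real. r \<in> {0<..<1}) (at_left 1)"
    by (rule eventually_at_left_real) auto
  ultimately have ev: "eventually (\<lambda>r. g (of_real r * t) = (\<Sum>n. a n * t ^ n * of_real r ^ n)) (at_left (1::real))"
  proof eventually_elim
    case (elim r)
    then have "of_real r * t \<in> ?S"
      using R by (auto simp: norm_mult R_def)
    then have "g (of_real r * t) = f (of_real r * t)"
      by (simp add: eq)
    then show ?case by (simp add: f_def power_mult_distrib mult_ac)
  qed
  have "isCont g t"
    using holomorphic_on_imp_continuous_on [OF hol] continuous_on_eq_continuous_at [OF op] t by blast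
  then have "((\<lambda>r. g (of_real r * t)) \<longlongrightarrow> g t) (at_left (1::real))"
    using lim by (intro isCont_tendsto_compose [of _ g]) auto
  then have "((\<lambda>r. \<Sum>n. a n * t ^ n * of_real r ^ n) \<longlongrightarrow> g t) (at_left (1::real))"
    by (rule Lim_transform_eventually) (use ev in auto)
  moreover have "((\<lambda>r. \<Sum>n. a n * t ^ n * of_real r ^ n) \<longlongrightarrow> (\<Sum>n. a n * t ^ n)) (at_left (1::real))"
    by (intro abel_radial_limit summable_sums summ)
  ultimately have "(\<Sum>n. a n * t ^ n) = g t"
    by (intro tendsto_unique [of "at_left (1::real)"]) auto
  with summ show ?thesis by (simp add: sums_iff)
qed

section \<open>Summation over weighted families\<close>

lemma sums_matrixI:
  fixes f :: "nat \<Rightarrow> complex ^ 'd ^ 'd"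
  assumes "\<And>j k. (\<lambda>n. f n $ j $ k) sums (L $ j $ k)"
  shows "f sums L"
  using assms unfolding sums_def by (intro vec_tendstoI) (simp add: sum_component)

lemma bounded_linear_entry: "bounded_linear (\<lambda>M :: complex ^ 'd ^ 'd. M $ j $ k)"
  by (intro bounded_linear_compose [OF bounded_linear_vec_nth bounded_linear_vec_nth])

lemma norm_entry_le: "norm (M $ j $ k) \<le> norm (M :: complex ^ 'd ^ 'd)"
  using Finite_Cartesian_Product.norm_nth_le [of M j] Finite_Cartesian_Product.norm_nth_le [of "M $ j" k]
  by linarith

text \<open>Locally uniform convergence of the net of finite partial sums, by the Weierstrass test on discs
  of radius \<open>R\<close> with \<open>R * s < 1\<close>. Phrasing the domain as \<open>norm w * s < 1\<close> includes the case \<open>s = 0\<close>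
  of an entire function.\<close>

lemma holomorphic_power_family:
  fixes a :: "'i \<Rightarrow> complex" and \<nu> :: "'i \<Rightarrow> nat"
  assumes s: "0 \<le> s" "s \<le> 1"
    and summ: "\<And>\<rho>::real. 0 \<le> \<rho> \<Longrightarrow> \<rho> * s < 1 \<Longrightarrow> (\<lambda>i. norm (a i) * \<rho> ^ \<nu> i) summable_on UNIV"
  shows "(\<lambda>w. \<Sum>\<^sub>\<infinity>i. w ^ \<nu> i * a i) holomorphic_on {w. norm w * s < 1}"
proof -
  define G where "G w = (\<Sum>\<^sub>\<infinity>i. w ^ \<nu> i * a i)" for w
  have hol: "G holomorphic_on ball 0 R" if R: "0 \<le> R" "R * s < 1" for R
  proof -
    have "uniform_limit (cball 0 R) (\<lambda>X w. \<Sum>i\<in>X. w ^ \<nu> i * a i) G (finite_subsets_at_top UNIV)"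
      unfolding G_def
    proof (rule Weierstrass_m_test_general)
      show "norm (w ^ \<nu> i * a i) \<le> norm (a i) * R ^ \<nu> i" if "w \<in> cball 0 R" for w i
        using that by (simp add: norm_mult norm_power mult.commute mult_left_mono power_mono)
    qed (use summ R in auto)
    then show ?thesis
      by (rule holomorphic_uniform_limit [rotated])
         (auto intro!: always_eventually continuous_intros holomorphic_intros)
  qed
  have "G field_differentiable at w" if w: "norm w * s < 1" for w
  proof -
    \<comment> \<open>Adding less than \<open>1 - norm w * s\<close> to the radius keeps \<open>R * s < 1\<close>, because \<open>s \<le> 1\<close>.\<close>
    define R where "R = norm w + (1 - norm w * s) / 2"
    have "(1 - norm w * s) / 2 * s \<le> (1 - norm w * s) / 2"
      using w s by (intro mult_left_le) auto
    then have "R * s \<le> norm w * s + (1 - norm w * s) / 2"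
      by (simp add: R_def distrib_right)
    then have "R * s < 1"
      using w by (simp add: field_simps)
    moreover have "norm w < R" "0 \<le> R"
      using w by (auto simp: R_def)
    ultimately show ?thesis
      using hol [of R] by (intro holomorphic_on_imp_differentiable_at [of _ "ball 0 R"]) auto
  qed
  then show ?thesis
    unfolding holomorphic_on_def G_def [symmetric] by (auto intro: field_differentiable_at_within)
qed

text \<open>Summation formula for a family \<open>b\<close> with weights \<open>\<nu>\<close> that converges absolutely after
  multiplication by \<open>\<rho> ^ \<nu> i\<close> for every \<open>\<rho> < 1 / s\<close>. Both formulae for the Horn function are
  instances. Near \<open>0\<close> it is the absolutely convergent rearrangement. Where only convergence of the
  series at \<open>t\<close> is known, it is extended to \<open>t\<close> entry by entry through \<open>sums_continuation\<close>, the right side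
  being holomorphic where \<open>norm (1 / (1 - t)) * s < 1\<close>.\<close>

lemma one_minus_pow_neg_mult_infsum:
  fixes M :: "complex ^ 'd ^ 'd" and b :: "'i \<Rightarrow> complex ^ 'd ^ 'd" and \<nu> :: "'i \<Rightarrow> nat"
  defines "S \<equiv> \<lambda>t n. (t ^ n / fact n) *\<^sub>m (\<Sum>\<^sub>\<infinity>i. mpoch (M + mat (of_nat (\<nu> i))) n ** b i)"
  assumes s: "0 \<le> s" "s < 1"
    and summ: "\<And>\<rho>::real. 0 \<le> \<rho> \<Longrightarrow> \<rho> * s < 1 \<Longrightarrow> (\<lambda>i. norm (b i) * \<rho> ^ \<nu> i) summable_on UNIV"
    and t: "norm t < 1 - s \<or> norm t < 1 \<and> s < norm (1 - t) \<and> summable (S t)"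
  shows "S t sums (one_minus_pow_neg t M ** (\<Sum>\<^sub>\<infinity>i. (1 / (1 - t)) ^ \<nu> i *\<^sub>m b i))"
proof -
  define F where "F u = one_minus_pow_neg u M ** (\<Sum>\<^sub>\<infinity>i. (1 / (1 - u)) ^ \<nu> i *\<^sub>m b i)" for u
  have loc: "S u sums F u" if "norm u < 1 - s" for u
    unfolding S_def F_def
  proof (rule one_minus_pow_neg_mult_infsum_local)
    show "norm u < 1" using that s by simp
    then show "(\<lambda>i. norm (b i) * (1 / (1 - norm u)) ^ \<nu> i) summable_on UNIV"
      using that by (intro summ) (auto simp: divide_simps)
  qed
  show ?thesis
  proof (cases "norm t < 1 - s")
    case True
    then show ?thesis using loc F_def by simp
  next
    case False
    with t have t: "norm t < 1" "s < norm (1 - t)" "summable (S t)" by auto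
    have "S t sums F t"
    proof (rule sums_matrixI)
      fix j k
      define a where "a n = (\<Sum>\<^sub>\<infinity>i. mpoch (M + mat (of_nat (\<nu> i))) n ** b i) $ j $ k / fact n" for n
      have S_entry: "S u n $ j $ k = a n * u ^ n" for u n
        by (simp add: S_def a_def)
      have "(\<lambda>n. a n * t ^ n) sums (F t $ j $ k)"
      proof (rule sums_continuation [where g = "\<lambda>u. F u $ j $ k", OF s])
        show "(\<lambda>n. a n * u ^ n) sums (F u $ j $ k)" if "norm u < 1 - s" for u
          using bounded_linear.sums [OF bounded_linear_entry loc [OF that], of j k] by (simp add: S_entry)
        show "t \<in> ball 0 1 - cball 1 s"
          using t by (simp add: dist_norm)
        show "summable (\<lambda>n. a n * t ^ n)"
          using bounded_linear.summable [OF bounded_linear_entry t(3), of j k] by (simp add: S_entry)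
        have P_hol: "(\<lambda>u. one_minus_pow_neg u M $ j $ l) holomorphic_on ball 0 1" for l
        proof (rule power_series_holomorphic)
          show "(\<lambda>n. (mpoch M n $ j $ l / fact n) * (u - 0) ^ n) sums (one_minus_pow_neg u M $ j $ l)"
            if "u \<in> ball 0 1" for u
            using bounded_linear.sums [OF bounded_linear_entry one_minus_pow_neg_sums [of u M], of j l] that
            by (simp add: mult_ac)
        qed
        let ?\<Omega> = "ball 0 1 - cball 1 s :: complex set"
        have w: "norm (1 / (1 - u)) * s < 1" if "u \<in> ?\<Omega>" for u
          using that s by (simp add: norm_divide dist_norm divide_simps)
        have G_hol: "(\<lambda>u. \<Sum>\<^sub>\<infinity>i. (1 / (1 - u)) ^ \<nu> i * b i $ l $ k) holomorphic_on ?\<Omega>" for l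
        proof -
          have G: "(\<lambda>w. \<Sum>\<^sub>\<infinity>i. w ^ \<nu> i * b i $ l $ k) holomorphic_on {w. norm w * s < 1}"
          proof (rule holomorphic_power_family)
            show "(\<lambda>i. norm (b i $ l $ k) * \<rho> ^ \<nu> i) summable_on UNIV"
              if "0 \<le> \<rho>" "\<rho> * s < 1" for \<rho>
              by (rule summable_on_comparison_test [OF summ [OF that]])
                 (use that in \<open>auto intro!: mult_right_mono norm_entry_le\<close>)
          qed (use s in auto)
          have "(\<lambda>u. 1 / (1 - u)) holomorphic_on ?\<Omega>"
            using s by (auto intro!: holomorphic_intros)
          from holomorphic_on_compose_gen [OF this G] show ?thesis
            using w by (force simp: o_def)
        qed
        have "F u $ j $ k = (\<Sum>l\<in>UNIV. one_minus_pow_neg u M $ j $ l *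
            (\<Sum>\<^sub>\<infinity>i. (1 / (1 - u)) ^ \<nu> i * b i $ l $ k))" if u: "u \<in> ?\<Omega>" for u
        proof -
          have "(\<lambda>i. (1 / (1 - u)) ^ \<nu> i *\<^sub>m b i) summable_on UNIV"
          proof (rule abs_summable_summable, rule summable_on_comparison_test)
            show "(\<lambda>i. norm (b i) * norm (1 / (1 - u)) ^ \<nu> i) summable_on UNIV"
              using w [OF u] by (intro summ) auto
          qed (simp_all add: norm_power norm_divide mult.commute)
          from has_sum_bounded_linear [OF bounded_linear_entry has_sum_infsum [OF this]]
          have "(\<Sum>\<^sub>\<infinity>i. (1 / (1 - u)) ^ \<nu> i *\<^sub>m b i) $ l $ k =
              (\<Sum>\<^sub>\<infinity>i. (1 / (1 - u)) ^ \<nu> i * b i $ l $ k)" for l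
            by (intro infsumI [symmetric]) (simp only: cscale_nth)
          then show ?thesis
            by (simp add: F_def matrix_matrix_mult_def)
        qed
        moreover have "(\<lambda>u. \<Sum>l\<in>UNIV. one_minus_pow_neg u M $ j $ l *
            (\<Sum>\<^sub>\<infinity>i. (1 / (1 - u)) ^ \<nu> i * b i $ l $ k)) holomorphic_on ?\<Omega>"
          by (intro holomorphic_intros G_hol holomorphic_on_subset [OF P_hol]) auto
        ultimately show "(\<lambda>u. F u $ j $ k) holomorphic_on ?\<Omega>"
          by (subst holomorphic_cong [OF refl]) auto
      qed
      then show "(\<lambda>n. S t n $ j $ k) sums (F t $ j $ k)"
        by (simp add: S_entry)
    qed
    then show ?thesis by (simp add: F_def)
  qed
qed

section \<open>Absolute convergence of the Horn series\<close>

text \<open>Grouping by \<open>N = m + n\<close> gives the geometric series with terms \<open>(p + q) ^ N\<close>.\<close>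

lemma summable_on_binomial_family:
  fixes p q :: real
  assumes "0 \<le> p" "0 \<le> q" "p + q < 1"
  shows "(\<lambda>(m, n). of_nat ((m + n) choose m) * p ^ m * q ^ n) summable_on UNIV"
proof -
  let ?f = "\<lambda>(m, n). of_nat ((m + n) choose m) * p ^ m * q ^ n"
  have "(\<lambda>(N, m). of_nat (N choose m) * p ^ m * q ^ (N - m)) summable_on (SIGMA N:UNIV. {..N})"
  proof (rule summable_on_SigmaI)
    show "((\<lambda>m. case (N, m) of (N, m) \<Rightarrow> of_nat (N choose m) * p ^ m * q ^ (N - m)) has_sum (p + q) ^ N) {..N}" for N
      by (simp add: binomial_ring has_sum_finite)
    show "(\<lambda>N. (p + q) ^ N) summable_on (UNIV :: nat set)"
      using assms by (intro norm_summable_imp_summable_on) (auto intro: summable_geometric simp: norm_power)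
  qed (use assms in auto)
  also have "?this \<longleftrightarrow> ?f summable_on UNIV"
    by (rule summable_on_reindex_bij_witness [where j = "\<lambda>(N, m). (m, N - m)" and i = "\<lambda>(m, n). (m + n, m)"])
       auto
  finally show ?thesis .
qed

lemma H4_domain_iff: "(x, y) \<in> H4_domain \<longleftrightarrow> 2 * sqrt (norm x) + norm y < 1"
  by (simp add: H4_domain_def)

text \<open>The coefficient is \<open>(2 * m + n choose 2 * m) * (2 * m choose m)\<close>, and the central binomial
  coefficient is at most \<open>2 ^ (2 * m)\<close>. The bound is a term of the family in
  \<open>summable_on_binomial_family\<close> with \<open>p = 2 * sqrt X\<close>, which explains the shape of \<open>H4_domain\<close>.\<close>

lemma H4_coefficient_bound:
  fixes X Y :: real
  assumes "0 \<le> X" "0 \<le> Y"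
  shows "fact (2 * m + n) / (fact m * fact m * fact n) * X ^ m * Y ^ n
    \<le> of_nat ((2 * m + n) choose (2 * m)) * (2 * sqrt X) ^ (2 * m) * Y ^ n"
proof -
  have "fact (2 * m + n) / (fact m * fact m * fact n :: real)
      = real ((2 * m + n) choose (2 * m)) * real ((2 * m) choose m)"
    by (simp add: binomial_fact field_simps)
  also have "\<dots> \<le> real ((2 * m + n) choose (2 * m)) * 2 ^ (2 * m)"
    by (intro mult_left_mono) (use of_nat_mono [OF binomial_le_pow2 [of "2 * m" m], where 'a = real] in auto)
  finally have "fact (2 * m + n) / (fact m * fact m * fact n) * (X ^ m * Y ^ n)
      \<le> real ((2 * m + n) choose (2 * m)) * 2 ^ (2 * m) * (X ^ m * Y ^ n)"
    using assms by (intro mult_right_mono) auto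
  moreover have "sqrt X ^ (2 * m) = X ^ m"
    using assms by (simp add: power_mult)
  ultimately show ?thesis
    by (simp add: power_mult_distrib mult_ac)
qed

text \<open>The four Pochhammer bounds cost a factor \<open>q ^ (3 * m + 3 * n)\<close>. It is absorbed by enlarging the
  arguments to \<open>norm x * q ^ 6\<close> and \<open>norm y * q ^ 3\<close>, which multiplies
  \<open>2 * sqrt (norm x) + norm y\<close> by \<open>q ^ 3\<close> and so stays in the domain for \<open>q\<close> close to \<open>1\<close>.\<close>

lemma H4_term_norm_summable:
  fixes A B C C' :: "complex ^ 'd ^ 'd"
  assumes invC: "\<And>k::nat. invertible (C + mat (of_nat k))"
    and invC': "\<And>k::nat. invertible (C' + mat (of_nat k))"
    and dom: "(x, y) \<in> H4_domain"
  shows "(\<lambda>(m, n). norm (H4_term A B C C' x y m n)) summable_on UNIV"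
proof -
  define s where "s = 2 * sqrt (norm x) + norm y"
  have s: "0 \<le> s" "s < 1"
    using dom by (auto simp: s_def H4_domain_iff)
  have "\<exists>q. 1 < q \<and> q ^ 3 * s < 1"
  proof -
    have "((\<lambda>q. q ^ 3 * s) \<longlongrightarrow> 1 ^ 3 * s) (at_right (1::real))"
      by (intro tendsto_intros)
    then have "eventually (\<lambda>q. q ^ 3 * s < 1) (at_right (1::real))"
      by (rule order_tendstoD) (use s in auto)
    then have "eventually (\<lambda>q. 1 < q \<and> q ^ 3 * s < 1) (at_right (1::real))"
      by (auto simp: eventually_at_right_less elim: eventually_elim2 [OF eventually_at_right_less])
    then show ?thesis
      by (intro eventually_happens' [of "at_right (1::real)"]) auto
  qed
  then obtain q where q: "1 < q" "q ^ 3 * s < 1" by blast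
  obtain K where K: "0 < K"
    "\<And>(M :: complex ^ 'd ^ 'd) (N :: complex ^ 'd ^ 'd). norm (M ** N) \<le> K * norm M * norm N"
    by (rule norm_matrix_mult_bound) blast
  obtain KA where KA: "0 < KA" "\<And>n. norm (mpoch A n) \<le> KA * q ^ n * fact n"
    by (rule norm_mpoch_le_fact [OF q(1)]) blast
  obtain KB where KB: "0 < KB" "\<And>n. norm (mpoch B n) \<le> KB * q ^ n * fact n"
    by (rule norm_mpoch_le_fact [OF q(1)]) blast
  obtain KC where KC: "0 < KC" "\<And>n. norm (matrix_inv (mpoch C n)) \<le> KC * q ^ n / fact n"
    by (rule norm_matrix_inv_mpoch_le_fact [OF invC q(1)]) blast
  obtain KC' where KC': "0 < KC'" "\<And>n. norm (matrix_inv (mpoch C' n)) \<le> KC' * q ^ n / fact n"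
    by (rule norm_matrix_inv_mpoch_le_fact [OF invC' q(1)]) blast
  define X Y where "X = norm x * q ^ 6" and "Y = norm y * q ^ 3"
  define L where "L = K ^ 3 * KA * KB * KC * KC'"
  have L: "0 < L" using K KA KB KC KC' by (simp add: L_def)
  have XY: "0 \<le> X" "0 \<le> Y" using q by (auto simp: X_def Y_def)
  have sqrtX: "sqrt X = sqrt (norm x) * q ^ 3"
  proof -
    have "X = norm x * (q ^ 3)\<^sup>2" by (simp add: X_def flip: power_mult)
    then have "sqrt X = sqrt (norm x) * \<bar>q ^ 3\<bar>"
      by (simp only: real_sqrt_mult real_sqrt_abs)
    then show ?thesis using q by simp
  qed
  have "2 * sqrt X + Y < 1"
    using q(2) by (simp add: sqrtX Y_def s_def algebra_simps)
  then have "(\<lambda>(m, n). of_nat ((m + n) choose m) * (2 * sqrt X) ^ m * Y ^ n) summable_on UNIV"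
    using XY by (intro summable_on_binomial_family) auto
  then have "(\<lambda>(m, n). of_nat ((m + n) choose m) * (2 * sqrt X) ^ m * Y ^ n)
      summable_on ((\<lambda>(m, n). (2 * m, n)) ` UNIV)"
    by (rule summable_on_subset_banach) auto
  then have "(\<lambda>(m, n). of_nat ((2 * m + n) choose (2 * m)) * (2 * sqrt X) ^ (2 * m) * Y ^ n)
      summable_on UNIV"
    by (subst (asm) summable_on_reindex) (auto simp: inj_on_def o_def case_prod_unfold)
  then have "(\<lambda>p. L * (case p of (m, n) \<Rightarrow>
      of_nat ((2 * m + n) choose (2 * m)) * (2 * sqrt X) ^ (2 * m) * Y ^ n)) summable_on UNIV"
    by (rule summable_on_cmult_right)
  then show ?thesis
  proof (rule summable_on_comparison_test, safe)
    fix m n :: nat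
    let ?A = "mpoch A (2 * m + n)" and ?B = "mpoch B n"
    let ?C = "matrix_inv (mpoch C m)" and ?C' = "matrix_inv (mpoch C' n)"
    have "norm (?A ** ?B ** ?C ** ?C') \<le> K * (K * (K * norm ?A * norm ?B) * norm ?C) * norm ?C'"
      using K(1) by (intro order_trans [OF K(2)] mult_right_mono mult_left_mono order_refl) auto
    also have "\<dots> = K ^ 3 * (norm ?A * norm ?B * norm ?C * norm ?C')"
      by (simp add: power3_eq_cube mult_ac)
    also have "\<dots> \<le> K ^ 3 * ((KA * q ^ (2 * m + n) * fact (2 * m + n)) * (KB * q ^ n * fact n) *
        (KC * q ^ m / fact m) * (KC' * q ^ n / fact n))"
      using K KA KB KC KC' q by (intro mult_left_mono mult_mono) auto
    also have "\<dots> = L * (fact (2 * m + n) / fact m) * q ^ (3 * m + 3 * n)"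
      by (simp add: L_def power_add field_simps power_mult [symmetric] eval_nat_numeral) 
    \<comment> \<open>The exponent is raised to \<open>3 * (2 * m + n)\<close> so that \<open>2 * sqrt (norm x)\<close> and \<open>norm y\<close> are both
      dilated by \<open>q ^ 3\<close>.\<close>
    also have "\<dots> \<le> L * (fact (2 * m + n) / fact m) * q ^ (6 * m + 3 * n)"
      using L q by (intro mult_left_mono power_increasing) auto
    finally have bnd: "norm (?A ** ?B ** ?C ** ?C') \<le> L * (fact (2 * m + n) / fact m) * q ^ (6 * m + 3 * n)" .
    have "norm (H4_term A B C C' x y m n) =
        norm x ^ m * norm y ^ n / (fact m * fact n) * norm (?A ** ?B ** ?C ** ?C')"
      by (simp add: H4_term_def norm_mult norm_divide norm_power)
    also have "\<dots> \<le> norm x ^ m * norm y ^ n / (fact m * fact n) *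
        (L * (fact (2 * m + n) / fact m) * q ^ (6 * m + 3 * n))"
      by (intro mult_left_mono bnd) auto
    also have "\<dots> = L * (fact (2 * m + n) / (fact m * fact m * fact n) * X ^ m * Y ^ n)"
      by (simp add: X_def Y_def power_add power_mult_distrib mult_ac flip: power_mult)
    also have "\<dots> \<le> L * (of_nat ((2 * m + n) choose (2 * m)) * (2 * sqrt X) ^ (2 * m) * Y ^ n)"
      using L XY by (intro mult_left_mono H4_coefficient_bound) auto
    finally show "norm (H4_term A B C C' x y m n) \<le>
        L * (of_nat ((2 * m + n) choose (2 * m)) * (2 * sqrt X) ^ (2 * m) * Y ^ n)" .
  qed auto
qed

section \<open>The summation formulae\<close>

lemma commute_mpoch_mpoch:
  fixes A B :: "complex ^ 'd ^ 'd"
  assumes "A ** B = B ** A"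
  shows "mpoch A m ** mpoch B n = mpoch B n ** mpoch A m"
  using assms by (intro mpoch_commute mpoch_commute [symmetric]) simp

lemma H4_term_scale:
  "H4_term A B C C' (x * u) (y * v) m n = (u ^ m * v ^ n) *\<^sub>m H4_term A B C C' x y m n"
  by (simp add: H4_term_def power_mult_distrib mult_ac)

lemma H4_mult_left:
  fixes A B C C' X :: "complex ^ 'd ^ 'd"
  assumes "\<And>k::nat. invertible (C + mat (of_nat k))" "\<And>k::nat. invertible (C' + mat (of_nat k))"
    and "(x, y) \<in> H4_domain"
  shows "X ** H4 A B C C' x y = (\<Sum>\<^sub>\<infinity>(m, n). X ** H4_term A B C C' x y m n)"
proof -
  have "(\<lambda>(m, n). H4_term A B C C' x y m n) summable_on UNIV"
    by (rule abs_summable_summable)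
       (use H4_term_norm_summable [OF assms] in \<open>simp add: case_prod_unfold\<close>)
  from has_sum_bounded_linear [OF
      bounded_bilinear.bounded_linear_right [OF bounded_bilinear_matrix_mult] has_sum_infsum [OF this]]
  show ?thesis
    by (intro infsumI [symmetric]) (simp add: H4_def case_prod_unfold)
qed

lemma mpoch_mult_H4_term_shift_A:
  fixes A B C C' :: "complex ^ 'd ^ 'd"
  shows "mpoch A n ** H4_term (A + mat (of_nat n)) B C C' x y m k =
    mpoch (A + mat (of_nat (2 * m + k))) n ** H4_term A B C C' x y m k"
  unfolding H4_term_def cscale_mult_right matrix_mul_assoc mpoch_shift_swap ..

text \<open>\<open>mpoch B n\<close> has to pass the factor \<open>mpoch A (2 * m + k)\<close> to meet the shifted symbol of \<open>B\<close>,
  and the exchanged symbol has to pass it back; this is where the commutation of \<open>A\<close> and \<open>B\<close> enters.\<close>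

lemma mpoch_mult_H4_term_shift_B:
  fixes A B C C' :: "complex ^ 'd ^ 'd"
  assumes "A ** B = B ** A"
  shows "mpoch B n ** H4_term A (B + mat (of_nat n)) C C' x y m k =
    mpoch (B + mat (of_nat k)) n ** H4_term A B C C' x y m k"
proof -
  have c: "mpoch A i ** mpoch (B + mat (of_nat j)) n = mpoch (B + mat (of_nat j)) n ** mpoch A i" for i j
    by (intro commute_mpoch_mpoch commute_add_mat [symmetric] assms [symmetric])
  have "mpoch B n ** (mpoch A (2 * m + k) ** mpoch (B + mat (of_nat n)) k) =
      mpoch A (2 * m + k) ** (mpoch B n ** mpoch (B + mat (of_nat n)) k)"
    by (simp only: matrix_mul_assoc commute_mpoch_mpoch [OF assms])
  also have "\<dots> = mpoch (B + mat (of_nat k)) n ** (mpoch A (2 * m + k) ** mpoch B k)"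
    by (simp only: mpoch_shift_swap matrix_mul_assoc c)
  finally show ?thesis
    unfolding H4_term_def cscale_mult_right matrix_mul_assoc by simp
qed

lemma H4_domain_scale_both:
  assumes "c \<noteq> 0"
  shows "(x / c\<^sup>2, y / c) \<in> H4_domain \<longleftrightarrow> 2 * sqrt (norm x) + norm y < norm c"
proof -
  have "2 * sqrt (norm (x / c\<^sup>2)) + norm (y / c) = (2 * sqrt (norm x) + norm y) / norm c"
    by (simp add: norm_divide norm_power real_sqrt_divide add_divide_distrib)
  then show ?thesis
    using assms by (simp add: H4_domain_iff)
qed

lemma H4_domain_scale_snd:
  assumes "c \<noteq> 0" "2 * sqrt (norm x) < 1"
  shows "(x, y / c) \<in> H4_domain \<longleftrightarrow> norm y / (1 - 2 * sqrt (norm x)) < norm c"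
  using assms by (simp add: H4_domain_iff norm_divide field_simps)

lemma H4_domain_fst: "(x, y) \<in> H4_domain \<Longrightarrow> 2 * sqrt (norm x) < 1"
  using norm_ge_zero [of y] by (simp add: H4_domain_iff del: norm_ge_zero)

theorem theorem5p7:
  fixes A B C C' :: "complex ^ 'd ^ 'd" and x y t :: complex
  assumes invC: "\<And>k::nat. invertible (C + mat (of_nat k))"
    and invC': "\<And>k::nat. invertible (C' + mat (of_nat k))"
    and t: "norm t < 1"
  defines "S1 \<equiv> (\<lambda>n. (t ^ n / fact n) *\<^sub>m (mpoch A n ** H4 (A + mat (of_nat n)) B C C' x y))"
    and "S2 \<equiv> (\<lambda>n. (t ^ n / fact n) *\<^sub>m (mpoch B n ** H4 A (B + mat (of_nat n)) C C' x y))"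
  shows
    "(((x, y) \<in> H4_domain \<and> (x / (1 - t)\<^sup>2, y / (1 - t)) \<in> H4_domain \<and> summable S1
        \<or> (x / (1 - of_real (norm t))\<^sup>2, y / (1 - of_real (norm t))) \<in> H4_domain)
       \<longrightarrow> S1 sums (one_minus_pow_neg t A ** H4 A B C C' (x / (1 - t)\<^sup>2) (y / (1 - t))))
     \<and>
     (A ** B = B ** A \<and>
       ((x, y) \<in> H4_domain \<and> (x, y / (1 - t)) \<in> H4_domain \<and> summable S2
        \<or> (x, y / (1 - of_real (norm t))) \<in> H4_domain)
       \<longrightarrow> S2 sums (one_minus_pow_neg t B ** H4 A B C C' x (y / (1 - t))))"
proof -
  define w where "w = 1 / (1 - t)"
  define r where "r = norm t"
  have t1: "1 - t \<noteq> 0" using t by auto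
  have r: "0 \<le> r" "r < 1" using t by (auto simp: r_def)
  have "(1 - of_real r :: complex) = of_real (1 - r)" by simp
  then have r1: "(1 - of_real r :: complex) \<noteq> 0" "norm (1 - of_real r :: complex) = 1 - r"
    using r by (simp_all only: norm_of_real of_real_eq_0_iff)
  note H4_summable = H4_term_norm_summable [OF invC invC']
  let ?b = "\<lambda>(m, n). H4_term A B C C' x y m n"
  show ?thesis
  proof (intro conjI impI)
    assume hyp: "(x, y) \<in> H4_domain \<and> (x / (1 - t)\<^sup>2, y / (1 - t)) \<in> H4_domain \<and> summable S1
        \<or> (x / (1 - of_real (norm t))\<^sup>2, y / (1 - of_real (norm t))) \<in> H4_domain"
    \<comment> \<open>\<open>1 - t\<close> enters the term with index \<open>(m, n)\<close> with exponent \<open>- (2 * m + n)\<close>; \<open>s\<close> is chosen so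
      that the dilation \<open>(x * \<rho>\<^sup>2, y * \<rho>)\<close> stays in the domain exactly for \<open>\<rho> * s < 1\<close>.\<close>
    define s where "s = 2 * sqrt (norm x) + norm y"
    have s0: "0 \<le> s" by (simp add: s_def)
    have cases: "s < 1 - r \<or> s < 1 \<and> s < norm (1 - t) \<and> summable S1"
      using hyp H4_domain_scale_both [OF t1, of x y] H4_domain_scale_both [OF r1(1), of x y]
        H4_domain_iff [of x y] unfolding r_def [symmetric] r1(2) s_def [symmetric] by blast
    then have s1: "s < 1" using r by auto
    let ?\<nu> = "\<lambda>(m, n). 2 * m + n"
    have S1_eq: "S1 = (\<lambda>n. (t ^ n / fact n) *\<^sub>m (\<Sum>\<^sub>\<infinity>i. mpoch (A + mat (of_nat (?\<nu> i))) n ** ?b i))"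
      using s1 unfolding S1_def
      by (subst H4_mult_left [OF invC invC'])
         (simp_all add: H4_domain_iff s_def mpoch_mult_H4_term_shift_A case_prod_unfold)
    have H4_eq: "H4 A B C C' (x / (1 - t)\<^sup>2) (y / (1 - t)) = (\<Sum>\<^sub>\<infinity>i. (1 / (1 - t)) ^ ?\<nu> i *\<^sub>m ?b i)"
      using H4_term_scale [of A B C C' x "w\<^sup>2" y w]
      by (simp add: H4_def case_prod_unfold w_def power_add power_mult power_divide)
    show "S1 sums (one_minus_pow_neg t A ** H4 A B C C' (x / (1 - t)\<^sup>2) (y / (1 - t)))"
      unfolding S1_eq H4_eq
    proof (rule one_minus_pow_neg_mult_infsum [OF s0 s1])
      show "(\<lambda>i. norm (?b i) * \<rho> ^ ?\<nu> i) summable_on UNIV" if \<rho>: "0 \<le> \<rho>" "\<rho> * s < 1" for \<rho>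
      proof -
        have "sqrt (norm x * \<rho>\<^sup>2) = sqrt (norm x) * \<rho>"
          using \<rho> by (simp add: real_sqrt_mult)
        then have "(x * (of_real \<rho>)\<^sup>2, y * of_real \<rho>) \<in> H4_domain"
          using \<rho> by (simp add: H4_domain_iff norm_mult norm_power s_def algebra_simps)
        then show ?thesis
          using H4_summable [of "x * (of_real \<rho>)\<^sup>2" "y * of_real \<rho>" A B] \<rho>
          by (simp add: H4_term_scale case_prod_unfold norm_mult norm_power power_add mult_ac flip: power_mult)
      qed
      show "norm t < 1 - s \<or> norm t < 1 \<and> s < norm (1 - t) \<and> summable
        (\<lambda>n. (t ^ n / fact n) *\<^sub>m (\<Sum>\<^sub>\<infinity>i. mpoch (A + mat (of_nat (?\<nu> i))) n ** ?b i))"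
        using cases t unfolding S1_eq r_def by auto
    qed
  next
    assume "A ** B = B ** A \<and>
       ((x, y) \<in> H4_domain \<and> (x, y / (1 - t)) \<in> H4_domain \<and> summable S2
        \<or> (x, y / (1 - of_real (norm t))) \<in> H4_domain)"
    \<comment> \<open>With \<open>y\<close> written as \<open>y / 1\<close>, the same criterion \<open>dom\<close> below covers all three memberships.\<close>
    then have AB: "A ** B = B ** A"
      and hyp: "(x, y / 1) \<in> H4_domain \<and> (x, y / (1 - t)) \<in> H4_domain \<and> summable S2
        \<or> (x, y / (1 - of_real (norm t))) \<in> H4_domain" by auto
    \<comment> \<open>Only \<open>y\<close> is dilated here, so the weight is the second index, and \<open>(x, y * \<rho>)\<close> stays in the
      domain exactly for \<open>\<rho> * s < 1\<close>.\<close>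
    define s where "s = norm y / (1 - 2 * sqrt (norm x))"
    have x: "2 * sqrt (norm x) < 1" using hyp H4_domain_fst by blast
    have s0: "0 \<le> s" using x by (simp add: s_def)
    have dom: "(x, y / c) \<in> H4_domain \<longleftrightarrow> s < norm c" if "c \<noteq> 0" for c
      using H4_domain_scale_snd [OF that x] by (simp add: s_def)
    have cases: "s < 1 - r \<or> s < 1 \<and> s < norm (1 - t) \<and> summable S2"
      using hyp by (simp only: dom [OF t1] r_def [symmetric] dom [OF r1(1)] r1(2) dom [OF one_neq_zero]
          norm_one) auto
    then have s1: "s < 1" using r by auto
    let ?\<nu> = "\<lambda>(m :: nat, n :: nat). n"
    have S2_eq: "S2 = (\<lambda>n. (t ^ n / fact n) *\<^sub>m (\<Sum>\<^sub>\<infinity>i. mpoch (B + mat (of_nat (?\<nu> i))) n ** ?b i))"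
      using s1 dom [of 1] unfolding S2_def
      by (subst H4_mult_left [OF invC invC'])
         (simp_all add: mpoch_mult_H4_term_shift_B [OF AB] case_prod_unfold)
    have H4_eq: "H4 A B C C' x (y / (1 - t)) = (\<Sum>\<^sub>\<infinity>i. (1 / (1 - t)) ^ ?\<nu> i *\<^sub>m ?b i)"
      using H4_term_scale [of A B C C' x 1 y w]
      by (simp add: H4_def case_prod_unfold w_def)
    show "S2 sums (one_minus_pow_neg t B ** H4 A B C C' x (y / (1 - t)))"
      unfolding S2_eq H4_eq
    proof (rule one_minus_pow_neg_mult_infsum [OF s0 s1])
      show "(\<lambda>i. norm (?b i) * \<rho> ^ ?\<nu> i) summable_on UNIV" if \<rho>: "0 \<le> \<rho>" "\<rho> * s < 1" for \<rho>
      proof -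
        have "(x * 1, y * of_real \<rho>) \<in> H4_domain"
          using \<rho> x by (simp add: H4_domain_iff norm_mult s_def field_simps)
        then show ?thesis
          using H4_summable [of "x * 1" "y * of_real \<rho>" A B] \<rho>
          by (simp only: H4_term_scale) (simp add: case_prod_unfold norm_mult norm_power mult_ac)
      qed
      show "norm t < 1 - s \<or> norm t < 1 \<and> s < norm (1 - t) \<and> summable
        (\<lambda>n. (t ^ n / fact n) *\<^sub>m (\<Sum>\<^sub>\<infinity>i. mpoch (B + mat (of_nat (?\<nu> i))) n ** ?b i))"
        using cases t unfolding S2_eq r_def by auto
    qed
  qed
qed

end
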